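(* Let $I\subseteq\mathbb{R}$ be an interval, let $a,b,c,f_5\in C^\infty(I)$ be real-valued with $c(x)\neq0$ on $I$, and fix a choice of sign $\pm$ (the same throughout). Suppose that for all $x\in I$ $$a(x)=\frac{b^2(x)-4c^2(x)f_5^2(x)}{4c(x)}+\frac{d}{dx}\left(-\frac{b}{2c}\pm f_5\right)(x).$$ Then the general solution of the Riccati equation $\frac{dy_\pm}{dx}=a(x)+b(x)y_\pm+c(x)y_\pm^2$ is $$y_\pm(x)=\frac{e^{\pm2\int^{x}c(\phi)f_5(\phi)\,d\phi}}{C_{\pm14}-\int^{x}c(\psi)\,e^{\pm2\int^{\psi}c(\phi)f_5(\phi)\,d\phi}\,d\psi}-\frac{b(x)}{2c(x)}\pm f_5(x),$$ where $C_{\pm14}$ is an arbitrary constant of integration.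
   Context: $\int^{x}g(\phi)\,d\phi$ denotes a fixed antiderivative of $g$ on $I$, the same one wherever the same integrand occurs. "The general solution is $y(x)=\frac{G(x)}{C-H(x)}+y_p(x)$ with $C$ an arbitrary constant" (here $y_p=-\frac{b}{2c}\pm f_5$) means: for every real $C$, this function satisfies the equation on every subinterval of $I$ on which $C-H$ does not vanish; and conversely every differentiable solution on a nondegenerate subinterval of $I$ is either of this form for some real $C$ (with nonvanishing denominator there) or equal to $y_p$ (the limiting case $C=\infty$). *)

theory Defs
  imports "HOL-Analysis.Analysis"
begin

text \<open>Derivatives are taken within the interval, hence one-sided at an endpoint belonging to it.\<close>

definition derivative_on :: "real set \<Rightarrow> (real \<Rightarrow> real) \<Rightarrow> real \<Rightarrow> real" where
  "derivative_on I f x = vector_derivative f (at x within I)"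

definition C_infinity_on :: "real set \<Rightarrow> (real \<Rightarrow> real) \<Rightarrow> bool" where
  "C_infinity_on I f \<longleftrightarrow> (\<forall>n. (derivative_on I ^^ n) f differentiable_on I)"

definition nondegenerate_interval :: "real set \<Rightarrow> bool" where
  "nondegenerate_interval J \<longleftrightarrow> is_interval J \<and> interior J \<noteq> {}"

definition antiderivative_on :: "real set \<Rightarrow> (real \<Rightarrow> real) \<Rightarrow> (real \<Rightarrow> real) \<Rightarrow> bool" where
  "antiderivative_on I g F \<longleftrightarrow> (\<forall>x\<in>I. (F has_real_derivative g x) (at x within I))"

definition riccati_solution_on ::
  "(real \<Rightarrow> real) \<Rightarrow> (real \<Rightarrow> real) \<Rightarrow> (real \<Rightarrow> real) \<Rightarrow> real set \<Rightarrow> (real \<Rightarrow> real) \<Rightarrow> bool" where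
  "riccati_solution_on a b c J y \<longleftrightarrow>
     (\<forall>x\<in>J. (y has_real_derivative a x + b x * y x + c x * (y x)\<^sup>2) (at x within J))"

text \<open>The family \<open>G / (C - H) + yp\<close>, with \<open>C\<close> an arbitrary real constant, is the general
  solution on \<open>I\<close>; the alternative \<open>y = yp\<close> is the limiting case of infinite \<open>C\<close>.\<close>

definition riccati_general_solution_on ::
  "(real \<Rightarrow> real) \<Rightarrow> (real \<Rightarrow> real) \<Rightarrow> (real \<Rightarrow> real) \<Rightarrow> real set \<Rightarrow>
   (real \<Rightarrow> real) \<Rightarrow> (real \<Rightarrow> real) \<Rightarrow> (real \<Rightarrow> real) \<Rightarrow> bool" where
  "riccati_general_solution_on a b c I G H yp \<longleftrightarrow>
     (\<forall>C J. is_interval J \<and> J \<subseteq> I \<and> (\<forall>x\<in>J. C - H x \<noteq> 0) \<longrightarrow>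
        riccati_solution_on a b c J (\<lambda>x. G x / (C - H x) + yp x)) \<and>
     (\<forall>y J. nondegenerate_interval J \<and> J \<subseteq> I \<and> riccati_solution_on a b c J y \<longrightarrow>
        (\<exists>C. \<forall>x\<in>J. C - H x \<noteq> 0 \<and> y x = G x / (C - H x) + yp x) \<or>
        (\<forall>x\<in>J. y x = yp x))"

end

theory Submission
  imports Defs
begin

text \<open>The hypothesis on \<open>a\<close> says exactly that \<open>yp = - b / (2 c) + s f\<^sub>5\<close> is a particular solution:
  completing the square, \<open>a + b yp + c yp\<^sup>2 = a - b\<^sup>2 / (4 c) + c (s f\<^sub>5)\<^sup>2\<close>. Writing \<open>y = u + yp\<close>
  turns the Riccati equation into the Bernoulli equation \<open>u' = p u + c u\<^sup>2\<close>, where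
  \<open>p = b + 2 c yp = 2 s c f\<^sub>5\<close>. The function \<open>G = exp (2 s F)\<close> is a positive solution of the
  linear part \<open>G' = p G\<close>, and \<open>H' = c G\<close>; hence every \<open>u = G / (C - H)\<close> solves the Bernoulli
  equation (lemma \<open>bernoulli_solution\<close>).

  For the converse one would like to divide by \<open>u\<close>, which requires knowing beforehand that a
  solution with one nonzero value never vanishes. This is avoided as follows. If \<open>u x0 \<noteq> 0\<close>, take
  the \<open>C\<close> for which \<open>u x0 = G x0 / (C - H x0)\<close> and look at the defect
  \<open>z = (u / G) (C - H) - 1\<close>. It satisfies the linear homogeneous equation \<open>z' = (c u) z\<close> and
  vanishes at \<open>x0\<close>, so it vanishes on the whole interval (lemma \<open>linear_ode_zero\<close>). The
  resulting identity \<open>u (C - H) = G > 0\<close> gives both the formula for \<open>u\<close> and the nonvanishing of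
  \<open>C - H\<close>.\<close>

text \<open>Multiplication by the integrating factor \<open>exp (- P)\<close>, with \<open>P\<close> an antiderivative of \<open>q\<close>,
  makes \<open>z\<close> constant. Since \<open>J\<close> need not be compact, \<open>P\<close> is taken on the closed segment from
  \<open>x0\<close> to the point under consideration.\<close>

lemma linear_ode_zero:
  fixes q z :: "real \<Rightarrow> real"
  assumes J: "is_interval J" and q: "continuous_on J q"
    and z: "\<And>x. x \<in> J \<Longrightarrow> (z has_real_derivative q x * z x) (at x within J)"
    and x0: "x0 \<in> J" "z x0 = 0" and x: "x \<in> J"
  shows "z x = 0"
proof -
  define l r where "l = min x0 x" and "r = max x0 x"
  have sub: "{l..r} \<subseteq> J"
  proof
    fix t assume "t \<in> {l..r}"
    moreover have "l \<in> J" "r \<in> J"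
      using x0 x by (auto simp: l_def r_def min_def max_def)
    ultimately show "t \<in> J"
      using mem_is_interval_1_I[OF J] by (meson atLeastAtMost_iff)
  qed
  obtain P where P: "\<And>t. t \<in> {l..r} \<Longrightarrow> (P has_vector_derivative q t) (at t within {l..r})"
    using antiderivative_continuous[OF continuous_on_subset[OF q sub]] by blast
  have "((\<lambda>t. z t * exp (- P t)) has_real_derivative 0) (at t within {l..r})"
    if t: "t \<in> {l..r}" for t
  proof -
    have [derivative_intros]: "(z has_real_derivative q t * z t) (at t within {l..r})"
      using z t sub DERIV_subset by blast
    have [derivative_intros]: "(P has_real_derivative q t) (at t within {l..r})"
      using P[OF t] by (simp add: has_real_derivative_iff_has_vector_derivative)
    show ?thesis
      by (auto intro!: derivative_eq_intros simp: algebra_simps)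
  qed
  then obtain k where k: "\<And>t. t \<in> {l..r} \<Longrightarrow> z t * exp (- P t) = k"
    using has_field_derivative_zero_constant[of "{l..r}" "\<lambda>t. z t * exp (- P t)"]
    by (metis convex_real_interval(5))
  have "k = 0"
    using k[of x0] x0 by (simp add: l_def r_def)
  then show ?thesis
    using k[of x] by (simp add: l_def r_def)
qed

text \<open>Subtracting a particular solution removes the inhomogeneous term \<open>a\<close>.\<close>

lemma riccati_solution_shift_iff:
  assumes "riccati_solution_on a b c J yp"
  shows "riccati_solution_on a b c J (\<lambda>x. u x + yp x) \<longleftrightarrow>
    riccati_solution_on (\<lambda>_. 0) (\<lambda>x. b x + 2 * c x * yp x) c J u"
proof -
  have "((\<lambda>x. u x + yp x) has_real_derivative
            a x + b x * (u x + yp x) + c x * (u x + yp x)\<^sup>2) (at x within J) \<longleftrightarrow>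
        (u has_real_derivative 0 + (b x + 2 * c x * yp x) * u x + c x * (u x)\<^sup>2) (at x within J)"
    (is "?L \<longleftrightarrow> ?R") if "x \<in> J" for x
  proof -
    have yp: "(yp has_real_derivative a x + b x * yp x + c x * (yp x)\<^sup>2) (at x within J)"
      using assms that by (simp add: riccati_solution_on_def)
    show ?thesis
    proof
      assume ?L
      from DERIV_diff[OF this yp] show ?R
        by (simp add: power2_eq_square algebra_simps)
    next
      assume ?R
      from DERIV_add[OF this yp] show ?L
        by (simp add: power2_eq_square algebra_simps)
    qed
  qed
  then show ?thesis
    unfolding riccati_solution_on_def by blast
qed

lemma bernoulli_solution:
  assumes G: "\<And>x. x \<in> J \<Longrightarrow> (G has_real_derivative p x * G x) (at x within J)"
    and H: "\<And>x. x \<in> J \<Longrightarrow> (H has_real_derivative c x * G x) (at x within J)"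
    and ne: "\<And>x. x \<in> J \<Longrightarrow> C - H x \<noteq> 0"
  shows "riccati_solution_on (\<lambda>_. 0) p c J (\<lambda>x. G x / (C - H x))"
  unfolding riccati_solution_on_def
proof
  fix x assume x: "x \<in> J"
  have quotient_rule: "(p x * G x * D - G x * (0 - c x * G x)) / (D * D) =
      0 + p x * (G x / D) + c x * (G x / D)\<^sup>2" if "D \<noteq> 0" for D
    using that by (simp add: field_simps power2_eq_square)
  show "((\<lambda>x. G x / (C - H x)) has_real_derivative
           0 + p x * (G x / (C - H x)) + c x * (G x / (C - H x))\<^sup>2) (at x within J)"
    using DERIV_divide[OF G[OF x] DERIV_diff[OF DERIV_const H[OF x]] ne[OF x]]
    unfolding quotient_rule[OF ne[OF x]] .
qed

text \<open>The constant is chosen to fit \<open>u\<close> at one point where it is nonzero; uniqueness for a linear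
  equation then propagates the fit to all of \<open>J\<close>. The coefficient \<open>c u\<close> of that equation
  involves the solution \<open>u\<close> itself. This is harmless, since \<open>u\<close> is given and \<open>linear_ode_zero\<close>
  only asks for continuity.\<close>

lemma bernoulli_solution_cases:
  assumes J: "is_interval J" and c: "continuous_on J c"
    and G: "\<And>x. x \<in> J \<Longrightarrow> (G has_real_derivative p x * G x) (at x within J)"
    and H: "\<And>x. x \<in> J \<Longrightarrow> (H has_real_derivative c x * G x) (at x within J)"
    and G_nz: "\<And>x. x \<in> J \<Longrightarrow> G x \<noteq> 0"
    and u: "riccati_solution_on (\<lambda>_. 0) p c J u"
  obtains (general) C where "\<And>x. x \<in> J \<Longrightarrow> C - H x \<noteq> 0 \<and> u x = G x / (C - H x)"
    | (zero) "\<And>x. x \<in> J \<Longrightarrow> u x = 0"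
proof (cases "\<forall>x\<in>J. u x = 0")
  case True
  then show ?thesis using zero by blast
next
  case False
  then obtain x0 where x0: "x0 \<in> J" "u x0 \<noteq> 0" by blast
  have u': "(u has_real_derivative p x * u x + c x * (u x)\<^sup>2) (at x within J)" if "x \<in> J" for x
    using u that by (simp add: riccati_solution_on_def)
  define C where "C = H x0 + G x0 / u x0"
  define z where "z = (\<lambda>x. u x / G x * (C - H x) - 1)"
  have "(z has_real_derivative c x * u x * z x) (at x within J)" if x: "x \<in> J" for x
  proof -
    \<comment> \<open>The linear part of the equation cancels against \<open>G\<close>.\<close>
    have v': "((\<lambda>x. u x / G x) has_real_derivative c x * (u x)\<^sup>2 / G x) (at x within J)"
      using DERIV_divide[OF u'[OF x] G[OF x] G_nz[OF x]] G_nz[OF x]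
      by (simp add: field_simps power2_eq_square)
    show ?thesis
      using DERIV_diff[OF DERIV_mult[OF v' DERIV_diff[OF DERIV_const H[OF x]]] DERIV_const]
        G_nz[OF x]
      unfolding z_def by (simp add: field_simps power2_eq_square)
  qed
  moreover have "continuous_on J (\<lambda>x. c x * u x)"
    using c DERIV_continuous_on[OF u'] by (intro continuous_intros)
  moreover have "z x0 = 0"
    using x0 G_nz[OF x0(1)] by (simp add: z_def C_def)
  ultimately have z0: "z x = 0" if "x \<in> J" for x
    using linear_ode_zero[OF J] x0(1) that by blast
  show ?thesis
  proof (rule general)
    fix x assume x: "x \<in> J"
    have "u x * (C - H x) = G x"
      using z0[OF x] G_nz[OF x] by (simp add: z_def field_simps)
    then show "C - H x \<noteq> 0 \<and> u x = G x / (C - H x)"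
      using G_nz[OF x] by (auto simp: eq_divide_eq)
  qed
qed

text \<open>One particular solution of a Riccati equation determines all others by two quadratures:
  \<open>ln \<bar>G\<bar>\<close> is an antiderivative of \<open>b + 2 c yp\<close>, and \<open>H\<close> one of \<open>c G\<close>.\<close>

theorem riccati_general_solution_from_particular:
  assumes c: "continuous_on I c"
    and yp: "riccati_solution_on a b c I yp"
    and G: "\<And>x. x \<in> I \<Longrightarrow> (G has_real_derivative (b x + 2 * c x * yp x) * G x) (at x within I)"
    and H: "\<And>x. x \<in> I \<Longrightarrow> (H has_real_derivative c x * G x) (at x within I)"
    and G_nz: "\<And>x. x \<in> I \<Longrightarrow> G x \<noteq> 0"
  shows "riccati_general_solution_on a b c I G H yp"
proof -
  have restrict: "riccati_solution_on a b c J yp"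
    "\<And>x. x \<in> J \<Longrightarrow> (G has_real_derivative (b x + 2 * c x * yp x) * G x) (at x within J)"
    "\<And>x. x \<in> J \<Longrightarrow> (H has_real_derivative c x * G x) (at x within J)"
    "\<And>x. x \<in> J \<Longrightarrow> G x \<noteq> 0"
    "continuous_on J c" if "J \<subseteq> I" for J
  proof -
    show "riccati_solution_on a b c J yp"
      using yp that DERIV_subset unfolding riccati_solution_on_def by blast
    show "continuous_on J c"
      using c that by (rule continuous_on_subset)
    fix x assume "x \<in> J"
    then have "x \<in> I"
      using that by blast
    show "(G has_real_derivative (b x + 2 * c x * yp x) * G x) (at x within J)"
      by (rule DERIV_subset[OF G[OF \<open>x \<in> I\<close>] that])
    show "(H has_real_derivative c x * G x) (at x within J)"
      by (rule DERIV_subset[OF H[OF \<open>x \<in> I\<close>] that])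
    show "G x \<noteq> 0"
      by (rule G_nz[OF \<open>x \<in> I\<close>])
  qed
  have "riccati_solution_on a b c J (\<lambda>x. G x / (C - H x) + yp x)"
    if "J \<subseteq> I" "\<forall>x\<in>J. C - H x \<noteq> 0" for C J
    unfolding riccati_solution_shift_iff[OF restrict(1)[OF that(1)]]
    using restrict[OF that(1)] that(2) by (intro bernoulli_solution) auto
  moreover have "(\<exists>C. \<forall>x\<in>J. C - H x \<noteq> 0 \<and> y x = G x / (C - H x) + yp x) \<or>
      (\<forall>x\<in>J. y x = yp x)"
    if "is_interval J" "J \<subseteq> I" "riccati_solution_on a b c J y" for y J
  proof -
    note r = restrict[OF that(2)]
    have u: "riccati_solution_on (\<lambda>_. 0) (\<lambda>x. b x + 2 * c x * yp x) c J (\<lambda>x. y x - yp x)"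
      using that(3) riccati_solution_shift_iff[OF r(1), of "\<lambda>x. y x - yp x"] by simp
    show ?thesis
    proof (rule bernoulli_solution_cases[OF that(1) r(5) r(2-4) u])
      fix C assume "\<And>x. x \<in> J \<Longrightarrow> C - H x \<noteq> 0 \<and> y x - yp x = G x / (C - H x)"
      then have "\<forall>x\<in>J. C - H x \<noteq> 0 \<and> y x = G x / (C - H x) + yp x"
        by (simp add: diff_eq_eq)
      then show ?thesis by blast
    next
      assume "\<And>x. x \<in> J \<Longrightarrow> y x - yp x = 0"
      then show ?thesis by simp
    qed
  qed
  ultimately show ?thesis
    unfolding riccati_general_solution_on_def nondegenerate_interval_def by blast
qed

lemma C_infinity_on_imp_differentiable_on:
  "C_infinity_on I f \<Longrightarrow> f differentiable_on I"
  unfolding C_infinity_on_def by (metis funpow_0)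

lemma derivative_on_works:
  assumes "f differentiable_on I" "x \<in> I"
  shows "(f has_real_derivative derivative_on I f x) (at x within I)"
  using assms unfolding derivative_on_def differentiable_on_def
  by (simp add: vector_derivative_works has_real_derivative_iff_has_vector_derivative)

theorem theorem10:
  fixes I :: "real set" and a b c f\<^sub>5 F H :: "real \<Rightarrow> real" and s :: real
  assumes "nondegenerate_interval I"
    and "C_infinity_on I a" "C_infinity_on I b" "C_infinity_on I c" "C_infinity_on I f\<^sub>5"
    and "\<forall>x\<in>I. c x \<noteq> 0"
    and "s \<in> {1, -1}"
    and "\<forall>x\<in>I. a x = ((b x)\<^sup>2 - 4 * (c x)\<^sup>2 * (f\<^sub>5 x)\<^sup>2) / (4 * c x)
           + derivative_on I (\<lambda>t. - b t / (2 * c t) + s * f\<^sub>5 t) x"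
    and "antiderivative_on I (\<lambda>x. c x * f\<^sub>5 x) F"
    and "antiderivative_on I (\<lambda>x. c x * exp (s * 2 * F x)) H"
  shows "riccati_general_solution_on a b c I
           (\<lambda>x. exp (s * 2 * F x)) H (\<lambda>x. - b x / (2 * c x) + s * f\<^sub>5 x)"
proof (rule riccati_general_solution_from_particular)
  let ?yp = "\<lambda>x. - b x / (2 * c x) + s * f\<^sub>5 x"
  have diff: "b differentiable_on I" "c differentiable_on I" "f\<^sub>5 differentiable_on I"
    using assms(3-5) by (auto intro: C_infinity_on_imp_differentiable_on)
  have s2: "s * s = 1"
    using assms(7) by auto
  show "continuous_on I c"
    using diff(2) by (rule differentiable_imp_continuous_on)
  have yp_diff: "?yp differentiable_on I"
    using diff assms(6) unfolding differentiable_on_def by (auto intro!: derivative_intros)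
  show "riccati_solution_on a b c I ?yp"
    unfolding riccati_solution_on_def
  proof
    fix x assume x: "x \<in> I"
    \<comment> \<open>This is the square left over when \<open>b x * ?yp x + c x * (?yp x)\<^sup>2\<close> is completed, because
      \<open>?yp x + b x / (2 * c x) = s * f\<^sub>5 x\<close>.\<close>
    have "c x * (s * f\<^sub>5 x)\<^sup>2 = c x * (f\<^sub>5 x)\<^sup>2"
      using s2 by (simp add: power2_eq_square)
    then have "b x * ?yp x + c x * (?yp x)\<^sup>2 =
        - (((b x)\<^sup>2 - 4 * (c x)\<^sup>2 * (f\<^sub>5 x)\<^sup>2) / (4 * c x))"
      using assms(6) x by (simp add: field_simps power2_eq_square)
    then have "derivative_on I ?yp x = a x + b x * ?yp x + c x * (?yp x)\<^sup>2"
      using bspec[OF assms(8) x] by linarith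
    then show "(?yp has_real_derivative a x + b x * ?yp x + c x * (?yp x)\<^sup>2) (at x within I)"
      using derivative_on_works[OF yp_diff x] by simp
  qed
  show "((\<lambda>x. exp (s * 2 * F x)) has_real_derivative
      (b x + 2 * c x * ?yp x) * exp (s * 2 * F x)) (at x within I)" if x: "x \<in> I" for x
  proof -
    have [derivative_intros]: "(F has_real_derivative c x * f\<^sub>5 x) (at x within I)"
      using assms(9) x by (simp add: antiderivative_on_def)
    have "b x + 2 * c x * ?yp x = s * 2 * (c x * f\<^sub>5 x)"
      using assms(6) x by (simp add: field_simps)
    then show ?thesis
      by (auto intro!: derivative_eq_intros)
  qed
  show "(H has_real_derivative c x * exp (s * 2 * F x)) (at x within I)" if "x \<in> I" for x
    using assms(10) that by (simp add: antiderivative_on_def)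
  show "exp (s * 2 * F x) \<noteq> 0" for x
    by simp
qed

end
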